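(* Let $p\ge1$. Consider the fully composite problem $\varphi^*=\min_{x\in\operatorname{dom}\varphi}\{\varphi(x)=F(x,f(x))\}$ (see context), where each component $f_i$, $i=1,\dots,m$, of $f$ is $p$ times continuously differentiable with $p$th derivative Lipschitz continuous with constant $L_p(f_i)\in(0,+\infty)$, and uniformly convex of degree $p+1$ with constant $\sigma_{p+1}(f_i)>0$. Let $\hat\beta_p(f)=\min_{1\le i\le m}\beta_p(f_i,p)$. Let $x_0\in\operatorname{dom}\varphi$ and let $\{x_k\}_{k\ge0}$ be generated by $$x_{k+1}\in\operatorname*{argmin}_{y\in\operatorname{dom}\varphi}F\Big(y,\ \Omega_p(f,x_k;y)+\tfrac{p\,L_p(f)}{(p+1)!}\|y-x_k\|^{p+1}\Big),\qquad k\ge0$$ (the Full-step $p$th order Basic Method; minimizers are assumed to exist). Then for all $k\ge0$, $$\varphi(x_k)-\varphi^*\ \le\ (1-\hat\beta_p(f))^k(\varphi(x_0)-\varphi^* ).$$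
   Context: $\mathbb{E}$ is a finite-dimensional real vector space with norm $\|x\|=\langle Bx,x\rangle^{1/2}$, where $B:\mathbb{E}\to\mathbb{E}^*$ is self-adjoint positive definite. Fully composite problem: $F:\mathbb{E}\times\mathbb{R}^m\to\mathbb{R}\cup\{+\infty\}$ is closed and convex; for every $x$, with $\mathcal{D}(x)=\{u:F(x,u)<+\infty\}\neq\emptyset$, the function $F(x,\cdot)$ is closed, convex and monotone: $u\le v$ componentwise implies $F(x,u)\le F(x,v)$ (as extended real values). $f=(f_1,\dots,f_m)^T:\operatorname{dom} f\to\mathbb{R}^m$ with $\operatorname{dom} f\subseteq\mathbb{E}$ open convex, and all $f_i$ closed and convex. $\varphi(x)=F(x,f(x))$, $\operatorname{dom}\varphi=\{x\in\operatorname{dom} f:(x,f(x))\in\operatorname{dom} F\}$, and a minimizer $x^*$ with $\varphi(x^* )=\varphi^*$ is assumed to exist. $D^kf(x)[h]^k$ is the $k$th directional derivative along $h$ repeated $k$ times (componentwise for vector functions); $\Omega_p(f,x;y)=f(x)+\sum_{k=1}^p\frac1{k!}D^kf(x)[y-x]^k$ is the (componentwise) Taylor polynomial. $\|D^pg(x)\|=\max\{D^pg(x)[h_1,\dots,h_p]:\|h_i\|\le1\}$, and $L_p(g)$ is a constant with $\|D^pg(x)-D^pg(y)\|\le L_p(g)\|x-y\|$ on $\operatorname{dom} f$; $L_p(f)=(L_p(f_1),\dots,L_p(f_m))^T$. Uniform convexity of degree $p+1$ of $g$: $\langle\nabla g(y)-\nabla g(x),y-x\rangle\ge\sigma_{p+1}(g)\|y-x\|^{p+1}$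 on $\operatorname{dom} f$. With $\gamma_p(g)=\sigma_{p+1}(g)/L_p(g)$, $\beta_p(g,\alpha)=\dfrac{(p!\,\gamma_p(g))^{1/p}}{(1+\alpha)^{1/p}+(p!\,\gamma_p(g))^{1/p}}$ for $\alpha\ge0$. *)

theory Defs
  imports "HOL-Analysis.Analysis"
begin

section \<open>The norm induced by a self-adjoint positive definite operator\<close>

text \<open>
  The dual space is \<^typ>\<open>'a \<Rightarrow>\<^sub>L real\<close>, and the pairing is application.  The norm of the type
  class only serves as a reference norm for topology and derivatives; these do not depend
  on it because the space is finite-dimensional.
\<close>

definition pos_def_operator :: "('a::euclidean_space \<Rightarrow> 'a \<Rightarrow>\<^sub>L real) \<Rightarrow> bool" where
  "pos_def_operator B \<longleftrightarrow> linear B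
     \<and> (\<forall>x y. blinfun_apply (B x) y = blinfun_apply (B y) x)
     \<and> (\<forall>x. x \<noteq> 0 \<longrightarrow> blinfun_apply (B x) x > 0)"

definition op_norm :: "('a::euclidean_space \<Rightarrow> 'a \<Rightarrow>\<^sub>L real) \<Rightarrow> 'a \<Rightarrow> real" where
  "op_norm B x = sqrt (blinfun_apply (B x) x)"

section \<open>Closed convex functions\<close>

text \<open>Functions with values in the reals together with plus infinity.\<close>

definition eff_dom :: "('a \<Rightarrow> ereal) \<Rightarrow> 'a set" where
  "eff_dom G = {z. G z < \<infinity>}"

definition ereal_epigraph :: "('a \<Rightarrow> ereal) \<Rightarrow> ('a \<times> real) set" where
  "ereal_epigraph G = {(z, t). G z \<le> ereal t}"

definition closed_convex_fun :: "('a::real_normed_vector \<Rightarrow> ereal) \<Rightarrow> bool" where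
  "closed_convex_fun G \<longleftrightarrow>
     (\<forall>z. G z \<noteq> -\<infinity>) \<and> convex (ereal_epigraph G) \<and> closed (ereal_epigraph G)"

definition closed_convex_on :: "'a::real_normed_vector set \<Rightarrow> ('a \<Rightarrow> real) \<Rightarrow> bool" where
  "closed_convex_on S g \<longleftrightarrow> convex_on S g \<and> closed (epigraph S g)"

section \<open>Fully composite problems\<close>

definition section_dom :: "('a \<times> (real^'m) \<Rightarrow> ereal) \<Rightarrow> 'a \<Rightarrow> (real^'m) set" where
  "section_dom F x = {u. F (x, u) < \<infinity>}"

definition composite_outer ::
  "('a::euclidean_space \<times> (real^'m) \<Rightarrow> ereal) \<Rightarrow> bool" where
  "composite_outer F \<longleftrightarrow> closed_convex_fun F
     \<and> (\<forall>x. section_dom F x \<noteq> {} \<longrightarrow>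
          closed_convex_fun (\<lambda>u. F (x, u))
          \<and> (\<forall>u v. (\<forall>i. u $ i \<le> v $ i) \<longrightarrow> F (x, u) \<le> F (x, v)))"

definition phi :: "('a \<times> (real^'m) \<Rightarrow> ereal) \<Rightarrow> ('a \<Rightarrow> real^'m) \<Rightarrow> 'a \<Rightarrow> ereal" where
  "phi F f x = F (x, f x)"

definition dom_phi :: "('a \<times> (real^'m) \<Rightarrow> ereal) \<Rightarrow> 'a set \<Rightarrow> ('a \<Rightarrow> real^'m) \<Rightarrow> 'a set" where
  "dom_phi F S f = {x \<in> S. (x, f x) \<in> eff_dom F}"

definition phi_opt :: "('a \<times> (real^'m) \<Rightarrow> ereal) \<Rightarrow> 'a set \<Rightarrow> ('a \<Rightarrow> real^'m) \<Rightarrow> ereal" where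
  "phi_opt F S f = (INF x\<in>dom_phi F S f. phi F f x)"

section \<open>Higher derivatives\<close>

text \<open>
  \<open>D_dir g [h\<^sub>1, \<dots>, h\<^sub>k] x\<close> is the \<open>k\<close>th derivative of \<open>g\<close> at \<open>x\<close> evaluated along
  \<open>h\<^sub>1, \<dots>, h\<^sub>k\<close>, obtained by iterating the first derivative.
\<close>

primrec D_dir :: "('a::euclidean_space \<Rightarrow> real) \<Rightarrow> 'a list \<Rightarrow> 'a \<Rightarrow> real" where
  "D_dir g [] x = g x"
| "D_dir g (h # hs) x = frechet_derivative (D_dir g hs) (at x) h"

text \<open>
  In finite dimension, continuity and differentiability of the \<open>k\<close>th derivative as a
  multilinear form are those of its values along every fixed tuple of directions.
\<close>

definition C_times :: "nat \<Rightarrow> ('a::euclidean_space \<Rightarrow> real) \<Rightarrow> 'a set \<Rightarrow> bool" where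
  "C_times p g S \<longleftrightarrow>
     (\<forall>hs. length hs < p \<longrightarrow> (\<forall>x\<in>S. D_dir g hs differentiable (at x)))
     \<and> (\<forall>hs. length hs \<le> p \<longrightarrow> continuous_on S (D_dir g hs))"

text \<open>
  For a \<open>p\<close>-linear form the set below is compact and nonempty, so the supremum is a maximum.
\<close>

definition form_norm ::
  "('a::euclidean_space \<Rightarrow> 'a \<Rightarrow>\<^sub>L real) \<Rightarrow> nat \<Rightarrow> ('a list \<Rightarrow> real) \<Rightarrow> real" where
  "form_norm B p T = Sup {T hs | hs. length hs = p \<and> (\<forall>h\<in>set hs. op_norm B h \<le> 1)}"

definition deriv_lipschitz_on ::
  "('a::euclidean_space \<Rightarrow> 'a \<Rightarrow>\<^sub>L real) \<Rightarrow> nat \<Rightarrow> real \<Rightarrow> ('a \<Rightarrow> real) \<Rightarrow> 'a set \<Rightarrow> bool" where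
  "deriv_lipschitz_on B p L g S \<longleftrightarrow>
     (\<forall>x\<in>S. \<forall>y\<in>S. form_norm B p (\<lambda>hs. D_dir g hs x - D_dir g hs y) \<le> L * op_norm B (x - y))"

text \<open>The argument \<open>q\<close> is the degree; the gradient is paired with \<open>y - x\<close>.\<close>

definition uniformly_convex_on ::
  "('a::euclidean_space \<Rightarrow> 'a \<Rightarrow>\<^sub>L real) \<Rightarrow> nat \<Rightarrow> real \<Rightarrow> ('a \<Rightarrow> real) \<Rightarrow> 'a set \<Rightarrow> bool" where
  "uniformly_convex_on B q \<sigma> g S \<longleftrightarrow>
     (\<forall>x\<in>S. \<forall>y\<in>S.
        frechet_derivative g (at y) (y - x) - frechet_derivative g (at x) (y - x)
          \<ge> \<sigma> * op_norm B (y - x) ^ q)"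

definition taylor :: "nat \<Rightarrow> ('a::euclidean_space \<Rightarrow> real^'m) \<Rightarrow> 'a \<Rightarrow> 'a \<Rightarrow> real^'m" where
  "taylor p f x y = (\<chi> i. f x $ i
     + (\<Sum>k=1..p. D_dir (\<lambda>z. f z $ i) (replicate k (y - x)) x / fact k))"

section \<open>The method and its rate\<close>

definition model ::
  "('a::euclidean_space \<Rightarrow> 'a \<Rightarrow>\<^sub>L real) \<Rightarrow> nat \<Rightarrow> real^'m \<Rightarrow> ('a \<times> (real^'m) \<Rightarrow> ereal)
     \<Rightarrow> ('a \<Rightarrow> real^'m) \<Rightarrow> 'a \<Rightarrow> 'a \<Rightarrow> ereal" where
  "model B p L F f x y =
     F (y, taylor p f x y + (real p / fact (p + 1) * op_norm B (y - x) ^ (p + 1)) *\<^sub>R L)"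

definition full_step_method ::
  "('a::euclidean_space \<Rightarrow> 'a \<Rightarrow>\<^sub>L real) \<Rightarrow> nat \<Rightarrow> real^'m \<Rightarrow> ('a \<times> (real^'m) \<Rightarrow> ereal)
     \<Rightarrow> 'a set \<Rightarrow> ('a \<Rightarrow> real^'m) \<Rightarrow> (nat \<Rightarrow> 'a) \<Rightarrow> bool" where
  "full_step_method B p L F S f x \<longleftrightarrow>
     (\<forall>k. is_arg_min (model B p L F f (x k)) (\<lambda>y. y \<in> dom_phi F S f) (x (Suc k)))"

text \<open>Here \<open>\<gamma>\<close> stands for the ratio of the uniform convexity and Lipschitz constants.\<close>

definition beta :: "nat \<Rightarrow> real \<Rightarrow> real \<Rightarrow> real" where
  "beta p \<gamma> \<alpha> = (fact p * \<gamma>) powr (1 / real p)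
     / ((1 + \<alpha>) powr (1 / real p) + (fact p * \<gamma>) powr (1 / real p))"

definition beta_hat :: "nat \<Rightarrow> real^'m \<Rightarrow> real^'m \<Rightarrow> real" where
  "beta_hat p L \<sigma> = Min (range (\<lambda>i. beta p (\<sigma> $ i / L $ i) (real p)))"

end

theory Submission
  imports Defs
begin

text \<open>
  Write \<open>M\<close> for the vector-valued model minimised in one step and \<open>r\<close> for the distance
  between its argument and the current iterate \<open>x\<close>.  Lipschitz continuity of the \<open>p\<close>th
  derivative puts each component of \<open>f\<close> within \<open>L r\<^sup>p\<^sup>+\<^sup>1 / (p+1)!\<close> of its Taylor polynomial
  (\<open>taylor_error\<close>).  Since \<open>M\<close> adds \<open>p\<close> times this error, and \<open>p \<ge> 1\<close>, it is squeezed
  between \<open>f\<close> and \<open>f + L r\<^sup>p\<^sup>+\<^sup>1 / p!\<close>.  Monotonicity of \<open>F\<close> in its second argument turns the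
  left inequality into \<open>\<phi>(x') \<le> F(x', M(x')) \<le> F(y, M(y))\<close> for the next iterate \<open>x'\<close> and
  every feasible \<open>y\<close>.

  The point to compare with is \<open>y = x + b (z - x)\<close>, where \<open>z\<close> is the minimiser of \<open>\<phi>\<close>.  With
  \<open>R\<close> the distance from \<open>x\<close> to \<open>z\<close>, the model overestimates \<open>f(y)\<close> by at most
  \<open>L b\<^sup>p\<^sup>+\<^sup>1 R\<^sup>p\<^sup>+\<^sup>1 / p!\<close>, while uniform convexity keeps \<open>f(y)\<close> below the chord by at least
  \<open>\<sigma> b (1 - b) R\<^sup>p\<^sup>+\<^sup>1 / (p+1)\<close> (\<open>uniformly_convex_chord_gap\<close>).  The choice of \<open>\<beta>\<close> is what makes
  the gap absorb the error: \<open>b \<le> \<beta>\<close> means \<open>(p+1) L b\<^sup>p \<le> p! \<sigma> (1 - b)\<^sup>p\<close>, and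
  \<open>(1 - b)\<^sup>p \<le> 1 - b\<close>.  Hence \<open>M(y) \<le> (1 - b) f(x) + b f(z)\<close> in every component, and
  monotonicity and joint convexity of \<open>F\<close> give \<open>\<phi>(x') \<le> (1 - b) \<phi>(x) + b \<phi>(z)\<close>
  (\<open>full_step_decrease\<close>).  This contracts the gap to the optimum by \<open>1 - b\<close>; the smallest of
  the \<open>\<beta>\<close> of the components serves all of them at once.

  Derivatives are given as iterated directional derivatives, and the norm of a form is a
  supremum of reals, which says something about the form only if the form is bounded.
  Therefore the iterated derivatives are first shown to be linear in every slot, hence
  bounded on the unit ball.
\<close>

section \<open>The induced norm\<close>

lemma op_norm_nonneg:
  assumes "pos_def_operator B"
  shows "op_norm B x \<ge> 0"
  using assms unfolding pos_def_operator_def op_norm_def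
  by (cases "x = 0") (auto simp: less_imp_le)

lemma op_norm_scaleR:
  assumes "pos_def_operator B"
  shows "op_norm B (c *\<^sub>R x) = \<bar>c\<bar> * op_norm B x"
proof -
  have "linear B"
    using assms by (simp add: pos_def_operator_def)
  then have "blinfun_apply (B (c *\<^sub>R x)) (c *\<^sub>R x) = c\<^sup>2 * blinfun_apply (B x) x"
    by (simp add: linear_scale blinfun.scaleR_left blinfun.scaleR_right power2_eq_square)
  then show ?thesis
    by (simp add: op_norm_def real_sqrt_mult)
qed

lemma op_norm_pos:
  assumes "pos_def_operator B" "x \<noteq> 0"
  shows "op_norm B x > 0"
  using assms by (simp add: pos_def_operator_def op_norm_def)

text \<open>
  The induced norm is continuous and positive on the compact Euclidean unit sphere, so it is
  bounded away from zero there; homogeneity extends this to all vectors.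
\<close>

lemma op_unit_ball_bounded:
  fixes B :: "'a::euclidean_space \<Rightarrow> 'a \<Rightarrow>\<^sub>L real"
  assumes B: "pos_def_operator B"
  obtains K where "\<And>h. op_norm B h \<le> 1 \<Longrightarrow> norm h \<le> K"
proof -
  have "bounded_linear B"
    using B by (simp add: pos_def_operator_def linear_conv_bounded_linear)
  then have "continuous_on (sphere 0 1) (op_norm B)"
    unfolding op_norm_def by (intro continuous_intros linear_continuous_on)
  moreover have "sphere (0::'a) 1 \<noteq> {}"
    by simp
  ultimately obtain u where u: "u \<in> sphere 0 1" "\<And>v. v \<in> sphere 0 1 \<Longrightarrow> op_norm B u \<le> op_norm B v"
    using continuous_attains_inf[OF compact_sphere] by metis
  have u_pos: "op_norm B u > 0"
    using u(1) by (intro op_norm_pos[OF B]) auto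
  have "norm h \<le> 1 / op_norm B u" if "op_norm B h \<le> 1" for h
  proof (cases "h = 0")
    case True
    then show ?thesis
      using u_pos by simp
  next
    case False
    have "op_norm B u \<le> op_norm B ((1 / norm h) *\<^sub>R h)"
      using False by (intro u(2)) simp
    also have "\<dots> = op_norm B h / norm h"
      by (simp add: op_norm_scaleR[OF B])
    also have "\<dots> \<le> 1 / norm h"
      using that by (simp add: divide_right_mono)
    finally show ?thesis
      using False u_pos by (simp add: field_simps)
  qed
  then show ?thesis
    by (rule that)
qed

section \<open>Iterated derivatives as multilinear forms\<close>

lemma D_dir_has_derivative:
  assumes "C_times p g S" "length hs < p" "x \<in> S"
  shows "(D_dir g hs has_derivative (\<lambda>h. D_dir g (h # hs) x)) (at x)"
  using assms by (simp add: C_times_def frechet_derivative_works)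

text \<open>
  The outermost slot is linear because it is the argument of a Frechet derivative.  An inner
  slot inherits linearity: if \<open>h \<mapsto> D_dir g (hs @ h # ks) z\<close> is linear at all \<open>z\<close> near \<open>x\<close>,
  the same identity between functions of \<open>z\<close> can be differentiated once more.  This is where
  openness of the domain matters.
\<close>

lemma D_dir_slot_linear:
  assumes C: "C_times p g S" and S: "open S"
  shows "length hs + length ks < p \<Longrightarrow> x \<in> S \<Longrightarrow> linear (\<lambda>h. D_dir g (hs @ h # ks) x)"
proof (induction hs arbitrary: x)
  case Nil
  then show ?case
    using has_derivative_linear[OF D_dir_has_derivative[OF C, of ks x]] by simp
next
  case (Cons k hs)
  have D: "(D_dir g (hs @ h # ks) has_derivative (\<lambda>k. D_dir g (k # hs @ h # ks) x)) (at x)" for h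
    using Cons.prems by (intro D_dir_has_derivative[OF C]) auto
  have lin: "linear (\<lambda>h. D_dir g (hs @ h # ks) z)" if "z \<in> S" for z
    using Cons that by simp
  show ?case
  proof (rule linearI)
    fix h h'
    have "((\<lambda>z. D_dir g (hs @ h # ks) z + D_dir g (hs @ h' # ks) z) has_derivative
        (\<lambda>k. D_dir g (k # hs @ h # ks) x + D_dir g (k # hs @ h' # ks) x)) (at x)"
      by (intro has_derivative_add D)
    then have "(D_dir g (hs @ (h + h') # ks) has_derivative
        (\<lambda>k. D_dir g (k # hs @ h # ks) x + D_dir g (k # hs @ h' # ks) x)) (at x)"
      by (rule has_derivative_transform_within_open[OF _ S Cons.prems(2)])
        (simp add: linear_add[OF lin])
    from has_derivative_unique[OF D this]
    show "D_dir g ((k # hs) @ (h + h') # ks) x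
        = D_dir g ((k # hs) @ h # ks) x + D_dir g ((k # hs) @ h' # ks) x"
      by (simp add: fun_eq_iff del: D_dir.simps)
  next
    fix c h
    have "((\<lambda>z. c *\<^sub>R D_dir g (hs @ h # ks) z) has_derivative
        (\<lambda>k. c *\<^sub>R D_dir g (k # hs @ h # ks) x)) (at x)"
      by (intro has_derivative_scaleR_right D)
    then have "(D_dir g (hs @ (c *\<^sub>R h) # ks) has_derivative
        (\<lambda>k. c *\<^sub>R D_dir g (k # hs @ h # ks) x)) (at x)"
      by (rule has_derivative_transform_within_open[OF _ S Cons.prems(2)])
        (simp add: linear_scale[OF lin])
    from has_derivative_unique[OF D this]
    show "D_dir g ((k # hs) @ (c *\<^sub>R h) # ks) x = c *\<^sub>R D_dir g ((k # hs) @ h # ks) x"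
      by (simp add: fun_eq_iff del: D_dir.simps)
  qed
qed

lemma multilinear_form_replicate_scaleR:
  fixes T :: "'a::real_vector list \<Rightarrow> real"
  assumes "\<And>hs ks. length hs + length ks + 1 = n \<Longrightarrow> linear (\<lambda>h. T (hs @ h # ks))"
  shows "T (replicate n (c *\<^sub>R u)) = c ^ n * T (replicate n u)"
  using assms
proof (induction n arbitrary: T)
  case 0
  then show ?case
    by simp
next
  case (Suc n)
  have "T (replicate (Suc n) (c *\<^sub>R u)) = c * T (u # replicate n (c *\<^sub>R u))"
    using linear_scale[OF Suc.prems[of "[]" "replicate n (c *\<^sub>R u)"], of c u] by simp
  also have "\<dots> = c * (c ^ n * T (u # replicate n u))"
    using Suc.IH[of "\<lambda>hs. T (u # hs)"] Suc.prems[of "u # _"] by simp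
  finally show ?case
    by simp
qed

text \<open>
  Expanding the first argument in the basis bounds the form by finitely many forms with one
  argument fewer.
\<close>

lemma multilinear_form_bounded:
  fixes T :: "'a::euclidean_space list \<Rightarrow> real"
  assumes "\<And>hs ks. length hs + length ks + 1 = n \<Longrightarrow> linear (\<lambda>h. T (hs @ h # ks))"
  shows "\<exists>C. \<forall>hs. length hs = n \<and> (\<forall>h\<in>set hs. norm h \<le> K) \<longrightarrow> \<bar>T hs\<bar> \<le> C"
  using assms
proof (induction n arbitrary: T)
  case 0
  then show ?case
    by auto
next
  case (Suc n)
  have "\<exists>C. \<forall>hs. length hs = n \<and> (\<forall>h\<in>set hs. norm h \<le> K) \<longrightarrow> \<bar>T (b # hs)\<bar> \<le> C" for b
    using Suc.IH[of "\<lambda>hs. T (b # hs)"] Suc.prems[of "b # _"] by simp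
  then obtain C where C: "\<And>b hs. length hs = n \<Longrightarrow> \<forall>h\<in>set hs. norm h \<le> K \<Longrightarrow> \<bar>T (b # hs)\<bar> \<le> C b"
    by metis
  have "\<bar>T hs'\<bar> \<le> (\<Sum>b\<in>Basis. K * C b)"
    if hs': "length hs' = Suc n" "\<forall>h\<in>set hs'. norm h \<le> K" for hs'
  proof -
    obtain h hs where hs: "hs' = h # hs" "length hs = n" "\<forall>k\<in>set hs. norm k \<le> K" "norm h \<le> K"
      using hs' by (cases hs') auto
    have lin: "linear (\<lambda>h. T (h # hs))"
      using Suc.prems[of "[]" hs] hs by simp
    have "T (h # hs) = T ((\<Sum>b\<in>Basis. (h \<bullet> b) *\<^sub>R b) # hs)"
      by (simp add: euclidean_representation)
    also have "\<dots> = (\<Sum>b\<in>Basis. (h \<bullet> b) * T (b # hs))"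
      using linear_sum[OF lin, of "\<lambda>b. (h \<bullet> b) *\<^sub>R b" Basis] by (simp add: linear_scale[OF lin])
    finally have "\<bar>T hs'\<bar> \<le> (\<Sum>b\<in>Basis. \<bar>(h \<bullet> b) * T (b # hs)\<bar>)"
      by (simp add: hs sum_abs)
    also have "\<dots> \<le> (\<Sum>b\<in>Basis. K * C b)"
    proof (rule sum_mono)
      fix b :: 'a
      assume b: "b \<in> Basis"
      have "\<bar>h \<bullet> b\<bar> \<le> K"
        using Basis_le_norm[OF b, of h] hs by simp
      moreover have "0 \<le> K"
        using hs(4) norm_ge_zero[of h] by linarith
      ultimately show "\<bar>(h \<bullet> b) * T (b # hs)\<bar> \<le> K * C b"
        using C[OF hs(2,3)] by (simp add: abs_mult mult_mono)
    qed
    finally show ?thesis .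
  qed
  then show ?case
    by blast
qed

text \<open>
  Boundedness is the point: the supremum of an unbounded set of reals is unspecified.
\<close>

lemma multilinear_form_le_form_norm:
  fixes T :: "'a::euclidean_space list \<Rightarrow> real"
  assumes B: "pos_def_operator B"
    and T: "\<And>hs ks. length hs + length ks + 1 = p \<Longrightarrow> linear (\<lambda>h. T (hs @ h # ks))"
    and hs: "length hs = p" "\<And>h. h \<in> set hs \<Longrightarrow> op_norm B h \<le> 1"
  shows "T hs \<le> form_norm B p T"
proof -
  obtain K where K: "\<And>h. op_norm B h \<le> 1 \<Longrightarrow> norm h \<le> K"
    by (rule op_unit_ball_bounded[OF B]) blast
  obtain C where C: "\<And>hs. length hs = p \<Longrightarrow> \<forall>h\<in>set hs. norm h \<le> K \<Longrightarrow> \<bar>T hs\<bar> \<le> C"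
    using multilinear_form_bounded[where T = T and n = p and K = K] T by blast
  have "bdd_above {T hs |hs. length hs = p \<and> (\<forall>h\<in>set hs. op_norm B h \<le> 1)}"
  proof (rule bdd_aboveI)
    fix t
    assume "t \<in> {T hs |hs. length hs = p \<and> (\<forall>h\<in>set hs. op_norm B h \<le> 1)}"
    then obtain ks where "t = T ks" "length ks = p" "\<forall>h\<in>set ks. op_norm B h \<le> 1"
      by blast
    then show "t \<le> C"
      using C[of ks] K by force
  qed
  then show ?thesis
    unfolding form_norm_def using hs by (intro cSup_upper) auto
qed

text \<open>
  Normalising \<open>h\<close> brings the repeated direction into the unit ball.  The inequality is
  one-sided, but \<open>x\<close> and \<open>y\<close> may be swapped.
\<close>

lemma D_dir_diff_le:
  assumes B: "pos_def_operator B" and C: "C_times p g S" and S: "open S"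
    and L: "deriv_lipschitz_on B p L g S" and x: "x \<in> S" and y: "y \<in> S"
  shows "D_dir g (replicate p h) x - D_dir g (replicate p h) y
    \<le> L * op_norm B (x - y) * op_norm B h ^ p"
proof -
  define T where "T hs = D_dir g hs x - D_dir g hs y" for hs
  have T: "linear (\<lambda>h. T (hs @ h # ks))" if "length hs + length ks + 1 = p" for hs ks
    unfolding T_def using that x y by (intro linear_compose_sub D_dir_slot_linear[OF C S]) auto
  \<comment> \<open>For \<open>h = 0\<close> the vector \<open>0\<close> also satisfies both properties below.\<close>
  define u where "u = (if h = 0 then 0 else (1 / op_norm B h) *\<^sub>R h)"
  have op0: "op_norm B 0 = 0"
    using op_norm_scaleR[OF B, of 0 0] by simp
  have u: "op_norm B u \<le> 1" and h: "h = op_norm B h *\<^sub>R u"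
    using op_norm_pos[OF B, of h] by (cases "h = 0"; simp add: u_def op0 op_norm_scaleR[OF B])+
  have "T (replicate p u) \<le> form_norm B p T"
    using u by (intro multilinear_form_le_form_norm[OF B T]) auto
  also have "\<dots> \<le> L * op_norm B (x - y)"
    using L x y by (simp add: deriv_lipschitz_on_def T_def[abs_def])
  finally have "op_norm B h ^ p * T (replicate p u) \<le> op_norm B h ^ p * (L * op_norm B (x - y))"
    by (intro mult_left_mono zero_le_power op_norm_nonneg[OF B])
  moreover have "T (replicate p h) = op_norm B h ^ p * T (replicate p u)"
    using multilinear_form_replicate_scaleR[where T = T and n = p, OF T] h by metis
  ultimately show ?thesis
    by (simp add: T_def mult_ac)
qed

section \<open>The Taylor remainder\<close>

text \<open>
  Here \<open>\<psi> k\<close> is the \<open>k\<close>th derivative of \<open>\<psi> 0\<close>.  The last one need not be differentiable, so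
  the remainder in Lagrange form, taken with \<open>\<psi> p\<close>, would yield only the constant \<open>1/p!\<close>.
  The sharp constant \<open>1/(p+1)!\<close> comes from integrating the Lipschitz-type bound \<open>p\<close> times:
  the derivative of the claimed slack for \<open>\<psi>\<close> is the slack for the shifted sequence.
\<close>

lemma taylor_remainder_le:
  fixes \<psi> :: "nat \<Rightarrow> real \<Rightarrow> real"
  assumes "\<And>k t. k < p \<Longrightarrow> 0 \<le> t \<Longrightarrow> t \<le> 1 \<Longrightarrow> (\<psi> k has_real_derivative \<psi> (Suc k) t) (at t)"
    and "\<And>t. 0 \<le> t \<Longrightarrow> t \<le> 1 \<Longrightarrow> \<psi> p t - \<psi> p 0 \<le> M * t"
    and "0 \<le> t" "t \<le> 1"
  shows "\<psi> 0 t - (\<Sum>k\<le>p. \<psi> k 0 * t ^ k / fact k) \<le> M * t ^ Suc p / fact (Suc p)"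
  using assms
proof (induction p arbitrary: \<psi> t)
  case 0
  then show ?case
    by simp
next
  case (Suc p)
  define R where "R t = M * t ^ Suc (Suc p) / fact (Suc (Suc p))
    - (\<psi> 0 t - (\<Sum>k\<le>Suc p. \<psi> k 0 * t ^ k / fact k))" for t
  define R' where "R' t = M * t ^ Suc p / fact (Suc p)
    - (\<psi> (Suc 0) t - (\<Sum>k\<le>p. \<psi> (Suc k) 0 * t ^ k / fact k))" for t
  have pow: "((\<lambda>t. c * t ^ Suc k / fact (Suc k)) has_real_derivative c * s ^ k / fact k) (at s)"
    for c s :: real and k
    by (rule DERIV_cong[OF DERIV_cdivide[OF DERIV_cmult[OF DERIV_pow]]])
      (simp add: field_simps del: of_nat_Suc)
  have "(R has_real_derivative R' s) (at s)" if "0 \<le> s" "s \<le> 1" for s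
  proof -
    have "R = (\<lambda>t. M * t ^ Suc (Suc p) / fact (Suc (Suc p))
      - (\<psi> 0 t - (\<psi> 0 0 + (\<Sum>k\<le>p. \<psi> (Suc k) 0 * t ^ Suc k / fact (Suc k)))))"
      unfolding R_def by (subst sum.atMost_Suc_shift) simp
    moreover have "(\<dots> has_real_derivative R' s) (at s)"
      unfolding R'_def using Suc.prems(1)[of 0 s] that
      by (auto intro!: DERIV_diff DERIV_sum pow DERIV_cong[OF DERIV_add[OF DERIV_const DERIV_sum[OF pow]]]
        simp del: fact_Suc power_Suc)
    ultimately show ?thesis
      by simp
  qed
  moreover have "R' s \<ge> 0" if "0 \<le> s" "s \<le> 1" for s
    using Suc.IH[of "\<lambda>k. \<psi> (Suc k)" s] Suc.prems(1,2) that by (simp add: R'_def)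
  ultimately have "R 0 \<le> R t"
    using Suc.prems(3,4) by (intro DERIV_nonneg_imp_nondecreasing[OF Suc.prems(3)]) force
  moreover have "R 0 = 0"
    by (simp add: R_def sum.atMost_Suc_shift del: sum.atMost_Suc)
  ultimately show ?case
    by (simp add: R_def)
qed

lemma D_dir_along_line:
  assumes C: "C_times p g S" and k: "k < p" and S: "x + t *\<^sub>R h \<in> S"
  shows "((\<lambda>t. D_dir g (replicate k h) (x + t *\<^sub>R h)) has_real_derivative
    D_dir g (replicate (Suc k) h) (x + t *\<^sub>R h)) (at t)"
proof -
  have D: "(D_dir g (replicate k h) has_derivative (\<lambda>v. D_dir g (v # replicate k h) (x + t *\<^sub>R h)))
      (at (x + t *\<^sub>R h))"
    using k by (intro D_dir_has_derivative[OF C _ S]) simp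
  have "((\<lambda>t. x + t *\<^sub>R h) has_derivative (\<lambda>s. s *\<^sub>R h)) (at t)"
    by (auto intro!: derivative_eq_intros)
  from has_derivative_compose[OF this D] show ?thesis
    using linear_scale[OF has_derivative_linear[OF D]]
    by (simp add: has_field_derivative_def mult_commute_abs del: D_dir.simps)
qed

lemma line_in_convex:
  fixes x :: "'a::real_vector"
  assumes "convex S" "x \<in> S" "y \<in> S" "0 \<le> t" "t \<le> 1"
  shows "x + t *\<^sub>R (y - x) \<in> S"
proof -
  have "x + t *\<^sub>R (y - x) = (1 - t) *\<^sub>R x + t *\<^sub>R y"
    by (simp add: algebra_simps)
  then show ?thesis
    using assms by (simp add: convexD)
qed

text \<open>
  The one-dimensional bound is applied on the segment from \<open>x\<close> to \<open>y\<close>, to the derivatives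
  and to their negatives.
\<close>

lemma taylor_error:
  fixes f :: "'a::euclidean_space \<Rightarrow> real^'m"
  assumes B: "pos_def_operator B" and C: "C_times p (\<lambda>z. f z $ i) S"
    and S: "open S" "convex S"
    and L: "deriv_lipschitz_on B p L (\<lambda>z. f z $ i) S" and x: "x \<in> S" and y: "y \<in> S"
  shows "\<bar>f y $ i - taylor p f x y $ i\<bar> \<le> L * op_norm B (y - x) ^ Suc p / fact (Suc p)"
proof -
  define g where "g z = f z $ i" for z
  define h where "h = y - x"
  define M where "M = L * op_norm B h ^ Suc p"
  define \<psi> where "\<psi> k t = D_dir g (replicate k h) (x + t *\<^sub>R h)" for k t
  have C': "C_times p g S" and L': "deriv_lipschitz_on B p L g S"
    using C L by (simp_all add: g_def[abs_def])
  have line: "x + t *\<^sub>R h \<in> S" if "0 \<le> t" "t \<le> 1" for t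
    unfolding h_def using that x y by (intro line_in_convex[OF S(2)])
  have deriv: "(\<psi> k has_real_derivative \<psi> (Suc k) t) (at t)" if "k < p" "0 \<le> t" "t \<le> 1" for k t
    unfolding \<psi>_def using that line by (intro D_dir_along_line[OF C']) auto
  have upper: "\<psi> p t - \<psi> p 0 \<le> M * t" and lower: "\<psi> p 0 - \<psi> p t \<le> M * t"
    if t: "0 \<le> t" "t \<le> 1" for t
    using D_dir_diff_le[OF B C' S(1) L' line[OF t] x, of h]
      D_dir_diff_le[OF B C' S(1) L' x line[OF t], of h] t
      op_norm_scaleR[OF B, of t h] op_norm_scaleR[OF B, of "-t" h]
    by (simp_all add: \<psi>_def M_def mult_ac)
  have "\<psi> 0 1 - (\<Sum>k\<le>p. \<psi> k 0 * 1 ^ k / fact k) \<le> M * 1 ^ Suc p / fact (Suc p)"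
    using deriv upper by (intro taylor_remainder_le) auto
  moreover have "(- \<psi> 0 1) - (\<Sum>k\<le>p. (- \<psi> k 0) * 1 ^ k / fact k) \<le> M * 1 ^ Suc p / fact (Suc p)"
    using deriv lower by (intro taylor_remainder_le[of p "\<lambda>k t. - \<psi> k t"]) (auto intro: DERIV_minus)
  ultimately have "\<bar>\<psi> 0 1 - (\<Sum>k\<le>p. \<psi> k 0 / fact k)\<bar> \<le> M / fact (Suc p)"
    by (simp add: sum_negf abs_le_iff)
  moreover have "\<psi> 0 1 = f y $ i"
    by (simp add: \<psi>_def h_def g_def)
  moreover have "(\<Sum>k\<le>p. \<psi> k 0 / fact k) = taylor p f x y $ i"
    by (simp add: taylor_def \<psi>_def h_def g_def[abs_def] atMost_atLeast0 sum.atLeast_Suc_atMost)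
  ultimately show ?thesis
    by (simp add: M_def h_def)
qed

section \<open>Uniform convexity along a segment\<close>

text \<open>
  A point \<open>y\<^sub>b = x + b (y - x)\<close> is approached simultaneously from both ends of the segment: at
  time \<open>u\<close> the left point sits at parameter \<open>b u\<close> and the right one at \<open>1 - (1 - b) u\<close>.  Their
  distance shrinks as \<open>1 - u\<close>, and \<open>b q(right) + (1 - b) q(left)\<close> moves from the chord to
  \<open>g(y\<^sub>b)\<close> with speed \<open>b (1 - b)\<close> times the difference of the slopes, which is at least
  \<open>\<sigma> (1 - u)\<^sup>p\<close> times \<open>\<parallel>y - x\<parallel>\<^sup>p\<^sup>+\<^sup>1\<close>.  Integrating over \<open>u\<close> from \<open>0\<close> to \<open>1\<close> gives the factor
  \<open>1/(p+1)\<close>.  This pairing of parameters keeps the full factor \<open>b (1 - b) / (p + 1)\<close>;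
  applying the gradient inequality at \<open>y\<^sub>b\<close> separately towards each end would multiply it by
  \<open>b\<^sup>p + (1 - b)\<^sup>p\<close>, which is too small for the rate when \<open>p \<ge> 2\<close> and \<open>b\<close> is small.
\<close>

lemma uniformly_convex_chord_gap:
  fixes g :: "'a::euclidean_space \<Rightarrow> real"
  assumes B: "pos_def_operator B" and S: "convex S"
    and diff: "\<And>z. z \<in> S \<Longrightarrow> g differentiable (at z)"
    and uc: "uniformly_convex_on B (p + 1) \<sigma> g S" and p: "p \<ge> 1"
    and x: "x \<in> S" and y: "y \<in> S" and b: "0 \<le> b" "b \<le> 1"
  shows "g (x + b *\<^sub>R (y - x)) + \<sigma> * b * (1 - b) / (p + 1) * op_norm B (y - x) ^ (p + 1)
    \<le> (1 - b) * g x + b * g y"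
proof -
  define h where "h = y - x"
  define R where "R = op_norm B h ^ (p + 1)"
  define q where "q t = g (x + t *\<^sub>R h)" for t
  define q' where "q' t = frechet_derivative g (at (x + t *\<^sub>R h)) h" for t
  have line: "x + t *\<^sub>R h \<in> S" if "0 \<le> t" "t \<le> 1" for t
    unfolding h_def using that x y by (intro line_in_convex[OF S])
  have D: "(g has_derivative frechet_derivative g (at (x + t *\<^sub>R h))) (at (x + t *\<^sub>R h))"
    if "0 \<le> t" "t \<le> 1" for t
    using diff[OF line[OF that]] by (simp add: frechet_derivative_works)
  have scale: "frechet_derivative g (at (x + t *\<^sub>R h)) (s *\<^sub>R h) = s * q' t"
    if "0 \<le> t" "t \<le> 1" for s t
    using linear_scale[OF has_derivative_linear[OF D[OF that]]] by (simp add: q'_def)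
  have deriv: "(q has_real_derivative q' t) (at t)" if "0 \<le> t" "t \<le> 1" for t
  proof -
    have "((\<lambda>t. x + t *\<^sub>R h) has_derivative (\<lambda>s. s *\<^sub>R h)) (at t)"
      by (auto intro!: derivative_eq_intros)
    from has_derivative_compose[OF this D[OF that]] show ?thesis
      by (simp add: has_field_derivative_def q_def[abs_def] scale[OF that] mult_commute_abs)
  qed
  have growth: "\<sigma> * (t - s) ^ p * R \<le> q' t - q' s" if st: "0 \<le> s" "s \<le> t" "t \<le> 1" for s t
  proof (cases "s = t")
    case True
    \<comment> \<open>The factor \<open>t - s\<close> cannot be cancelled here, but \<open>0 ^ p = 0\<close> as \<open>p \<ge> 1\<close>.\<close>
    then show ?thesis
      using p by (simp add: power_0_left)
  next
    case False
    have "(x + t *\<^sub>R h) - (x + s *\<^sub>R h) = (t - s) *\<^sub>R h"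
      by (simp add: algebra_simps)
    then have "\<sigma> * op_norm B ((t - s) *\<^sub>R h) ^ (p + 1) \<le> (t - s) * q' t - (t - s) * q' s"
      using uc line[of s] line[of t] st scale[of s "t - s"] scale[of t "t - s"]
      unfolding uniformly_convex_on_def by force
    moreover have "op_norm B ((t - s) *\<^sub>R h) ^ (p + 1) = (t - s) * (t - s) ^ p * R"
      using st by (simp add: op_norm_scaleR[OF B] power_mult_distrib R_def)
    ultimately have "(t - s) * (\<sigma> * (t - s) ^ p * R) \<le> (t - s) * (q' t - q' s)"
      by (simp add: right_diff_distrib mult_ac)
    then show ?thesis
      using False st by (simp add: mult_le_cancel_left_pos)
  qed
  \<comment> \<open>The last term is the integral of the guaranteed speed over the remaining time.\<close>
  define \<Phi> where "\<Phi> u = b * q (1 - (1 - b) * u) + (1 - b) * q (b * u)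
    - \<sigma> * b * (1 - b) * R / (p + 1) * (1 - u) ^ Suc p" for u
  define \<Phi>' where "\<Phi>' u = b * (1 - b) * (q' (b * u) - q' (1 - (1 - b) * u)
    + \<sigma> * (1 - u) ^ p * R)" for u
  have "(\<Phi> has_real_derivative \<Phi>' u) (at u)" and "\<Phi>' u \<le> 0" if u: "0 \<le> u" "u \<le> 1" for u
  proof -
    have "b * u + (1 - b) * u \<le> 1"
      using u by (simp add: algebra_simps)
    moreover have "0 \<le> b * u" "0 \<le> (1 - b) * u"
      using u b by simp_all
    ultimately have "0 \<le> b * u" "b * u \<le> 1 - (1 - b) * u" "1 - (1 - b) * u \<le> 1"
      by linarith+
    note range = this
    have "(1 - (1 - b) * u) - b * u = 1 - u"
      by (simp add: algebra_simps)
    then have "\<sigma> * (1 - u) ^ p * R \<le> q' (1 - (1 - b) * u) - q' (b * u)"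
      using growth[OF range] by metis
    then show "\<Phi>' u \<le> 0"
      unfolding \<Phi>'_def using b by (intro mult_nonneg_nonpos) auto
    have "((\<lambda>u. q (1 - (1 - b) * u)) has_real_derivative q' (1 - (1 - b) * u) * - (1 - b)) (at u)"
      using range by (intro DERIV_chain2 deriv) (auto intro!: derivative_eq_intros)
    moreover have "((\<lambda>u. q (b * u)) has_real_derivative q' (b * u) * b) (at u)"
      using range by (intro DERIV_chain2 deriv) (auto intro!: derivative_eq_intros)
    moreover have "((\<lambda>u. (1 - u) ^ Suc p) has_real_derivative - (p + 1) * (1 - u) ^ p) (at u)"
    proof -
      have "((\<lambda>u. 1 - u) has_real_derivative - 1) (at u)"
        by (auto intro!: derivative_eq_intros)
      from DERIV_power_Suc[OF this, of p] show ?thesis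
        by (simp add: algebra_simps del: power_Suc)
    qed
    ultimately show "(\<Phi> has_real_derivative \<Phi>' u) (at u)"
      unfolding \<Phi>_def
      by (rule DERIV_cong[OF DERIV_diff[OF DERIV_add[OF DERIV_cmult DERIV_cmult] DERIV_cmult]])
        (simp add: \<Phi>'_def field_simps)
  qed
  then have "\<Phi> 1 \<le> \<Phi> 0"
    by (intro DERIV_nonpos_imp_nonincreasing[of 0 1 \<Phi>]) auto
  then show ?thesis
    by (simp add: \<Phi>_def q_def h_def R_def algebra_simps)
qed

section \<open>The contraction factor\<close>

lemma beta_bounds:
  assumes "\<gamma> > 0" "\<alpha> \<ge> 0"
  shows "0 < beta p \<gamma> \<alpha>" "beta p \<gamma> \<alpha> < 1"
proof -
  have "(fact p * \<gamma>) powr (1 / real p) > 0" "(1 + \<alpha>) powr (1 / real p) > 0"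
    using assms by simp_all
  then show "0 < beta p \<gamma> \<alpha>" "beta p \<gamma> \<alpha> < 1"
    by (simp_all add: beta_def field_simps add_pos_pos)
qed

text \<open>
  \<open>\<beta>\<close> solves \<open>b / (1 - b) = (p! \<gamma> / (1 + \<alpha>))\<close> to the power \<open>1/p\<close>, and the left-hand side
  increases with \<open>b\<close>; clearing the root leaves a polynomial inequality.
\<close>

lemma le_beta_imp_power_le:
  assumes p: "p \<ge> 1" and \<gamma>: "\<gamma> > 0" and \<alpha>: "\<alpha> \<ge> 0" and b: "0 \<le> b" "b \<le> beta p \<gamma> \<alpha>"
  shows "(1 + \<alpha>) * b ^ p \<le> fact p * \<gamma> * (1 - b) ^ p"
proof -
  define a where "a = (fact p * \<gamma>) powr (1 / real p)"
  define d where "d = (1 + \<alpha>) powr (1 / real p)"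
  have pos: "a > 0" "d > 0"
    using \<gamma> \<alpha> by (simp_all add: a_def d_def)
  have "b \<le> a / (d + a)"
    using b(2) by (simp add: beta_def a_def d_def)
  then have "d * b \<le> a * (1 - b)"
    using pos by (simp add: field_simps)
  then have "(d * b) ^ p \<le> (a * (1 - b)) ^ p"
    using pos b(1) by (intro power_mono) auto
  moreover have "a ^ p = fact p * \<gamma>" "d ^ p = 1 + \<alpha>"
    using p \<gamma> \<alpha> by (simp_all add: a_def d_def powr_realpow[symmetric] powr_powr)
  ultimately show ?thesis
    by (simp add: power_mult_distrib)
qed

section \<open>One step of the method\<close>

lemma closed_convex_fun_le_convex_combination:
  assumes G: "closed_convex_fun G" and v: "G v = ereal c" and w: "G w = ereal d"
    and b: "0 \<le> b" "b \<le> 1"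
  shows "G ((1 - b) *\<^sub>R v + b *\<^sub>R w) \<le> ereal ((1 - b) * c + b * d)"
proof -
  have "convex (ereal_epigraph G)"
    using G by (simp add: closed_convex_fun_def)
  moreover have "(v, c) \<in> ereal_epigraph G" "(w, d) \<in> ereal_epigraph G"
    using v w by (simp_all add: ereal_epigraph_def)
  ultimately have "(1 - b) *\<^sub>R (v, c) + b *\<^sub>R (w, d) \<in> ereal_epigraph G"
    using b by (intro convexD) auto
  then show ?thesis
    by (simp add: ereal_epigraph_def)
qed

text \<open>
  Monotonicity of \<open>F x\<close> is only available at \<open>x\<close> with a nonempty section; a finite upper
  value provides a point of that section.
\<close>

lemma composite_outer_mono:
  assumes "composite_outer F" "F (x, v) < \<infinity>" "\<And>i. u $ i \<le> v $ i"
  shows "F (x, u) \<le> F (x, v)"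
proof -
  have "section_dom F x \<noteq> {}"
    using assms(2) by (auto simp: section_dom_def)
  then show ?thesis
    using assms by (simp add: composite_outer_def)
qed

text \<open>
  The minimiser property is used against the single competitor \<open>y = x + b (z - x)\<close>.  The
  condition on \<open>b\<close> is the polynomial form of \<open>b \<le> \<beta>\<close>; it bounds the model error at \<open>y\<close> by
  the gap between \<open>f\<close> and its chord.
\<close>

lemma full_step_decrease:
  fixes B :: "'a::euclidean_space \<Rightarrow> 'a \<Rightarrow>\<^sub>L real"
    and F :: "'a \<times> (real^'m) \<Rightarrow> ereal" and f :: "'a \<Rightarrow> real^'m"
  assumes p: "p \<ge> 1" and B: "pos_def_operator B" and F: "composite_outer F"
    and S: "open S" "convex S"
    and smooth: "\<And>i. C_times p (\<lambda>z. f z $ i) S"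
    and L_pos: "\<And>i. L $ i > 0"
    and lipschitz: "\<And>i. deriv_lipschitz_on B p (L $ i) (\<lambda>z. f z $ i) S"
    and \<sigma>_pos: "\<And>i. \<sigma> $ i > 0"
    and uc: "\<And>i. uniformly_convex_on B (p + 1) (\<sigma> $ i) (\<lambda>z. f z $ i) S"
    and b: "0 \<le> b" "b \<le> 1"
    and b_le: "\<And>i. (1 + p) * b ^ p \<le> fact p * (\<sigma> $ i / L $ i) * (1 - b) ^ p"
    and x: "x \<in> dom_phi F S f" and z: "z \<in> dom_phi F S f"
    and next_iterate: "is_arg_min (model B p L F f x) (\<lambda>y. y \<in> dom_phi F S f) x'"
    and vals: "phi F f x = ereal c" "phi F f z = ereal d"
  shows "phi F f x' \<le> ereal ((1 - b) * c + b * d)"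
proof -
  define y where "y = x + b *\<^sub>R (z - x)"
  define w where "w = (1 - b) *\<^sub>R f x + b *\<^sub>R f z"
  define r where "r = op_norm B (z - x)"
  define \<Omega> where "\<Omega> v = taylor p f x v + (real p / fact (p + 1) * op_norm B (v - x) ^ (p + 1)) *\<^sub>R L" for v
  have xS: "x \<in> S" and zS: "z \<in> S" and x'S: "x' \<in> S" and x'_fin: "F (x', f x') < \<infinity>"
    using x z next_iterate by (auto simp: dom_phi_def eff_dom_def is_arg_min_def)
  have yS: "y \<in> S"
    unfolding y_def by (rule line_in_convex[OF S(2) xS zS b])
  have r_nonneg: "r \<ge> 0"
    by (simp add: r_def op_norm_nonneg[OF B])
  have err: "\<bar>f v $ i - taylor p f x v $ i\<bar> \<le> L $ i * op_norm B (v - x) ^ Suc p / fact (Suc p)"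
    if "v \<in> S" for v i
    by (rule taylor_error[OF B smooth S lipschitz xS that])
  \<comment> \<open>The regularisation in the model is \<open>p \<ge> 1\<close> times the Taylor error, so it dominates it.\<close>
  have f_le: "f v $ i \<le> \<Omega> v $ i" if v: "v \<in> S" for v i
  proof -
    have "1 * (L $ i * op_norm B (v - x) ^ Suc p / fact (Suc p))
        \<le> p * (L $ i * op_norm B (v - x) ^ Suc p / fact (Suc p))"
      using p L_pos[of i] op_norm_nonneg[OF B] by (intro mult_right_mono) auto
    then show ?thesis
      using err[OF v, of i] by (simp add: \<Omega>_def abs_le_iff mult_ac del: fact_Suc power_Suc)
  qed
  have \<Omega>_le: "\<Omega> y $ i \<le> w $ i" for i
  proof -
    have "\<sigma> $ i * b * (1 - b) / (p + 1) * r ^ (p + 1) + f y $ i \<le> w $ i"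
    proof -
      have "(\<lambda>v. f v $ i) differentiable (at v)" if "v \<in> S" for v
      proof -
        have "D_dir (\<lambda>v. f v $ i) [] differentiable (at v)"
          using smooth[of i] p that by (simp add: C_times_def del: D_dir.simps)
        moreover have "D_dir (\<lambda>v. f v $ i) [] = (\<lambda>v. f v $ i)"
          by (rule ext) simp
        ultimately show ?thesis
          by simp
      qed
      from uniformly_convex_chord_gap[OF B S(2) this uc[of i] p xS zS b] show ?thesis
        by (simp add: w_def y_def r_def add.commute)
    qed
    moreover have "L $ i / fact p * (b * r) ^ Suc p \<le> \<sigma> $ i * b * (1 - b) / (p + 1) * r ^ (p + 1)"
    proof -
      have "L $ i * ((1 + p) * b ^ p) \<le> L $ i * (fact p * (\<sigma> $ i / L $ i) * (1 - b) ^ p)"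
        using L_pos[of i] b_le[of i] by (intro mult_left_mono) auto
      also have "\<dots> = fact p * \<sigma> $ i * (1 - b) ^ p"
        using L_pos[of i] by simp
      also have "\<dots> \<le> fact p * \<sigma> $ i * (1 - b)"
        using power_decreasing[of 1 p "1 - b"] p b \<sigma>_pos[of i] by (intro mult_left_mono) auto
      finally have "L $ i / fact p * b ^ p \<le> \<sigma> $ i * (1 - b) / (p + 1)"
        by (simp add: field_simps)
      then have "(L $ i / fact p * b ^ p) * (b * r ^ Suc p) \<le> (\<sigma> $ i * (1 - b) / (p + 1)) * (b * r ^ Suc p)"
        using b r_nonneg by (intro mult_right_mono) auto
      then show ?thesis
        by (simp add: power_mult_distrib mult_ac)
    qed
    moreover have "\<Omega> y $ i \<le> f y $ i + L $ i / fact p * (b * r) ^ Suc p"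
    proof -
      define e where "e = L $ i * (b * r) ^ Suc p / fact (Suc p)"
      have "op_norm B (y - x) = b * r"
        using b by (simp add: y_def r_def op_norm_scaleR[OF B])
      then have "taylor p f x y $ i \<le> f y $ i + e" and "\<Omega> y $ i = taylor p f x y $ i + p * e"
        using err[OF yS, of i]
        by (simp_all add: \<Omega>_def e_def abs_le_iff mult_ac del: fact_Suc power_Suc)
      \<comment> \<open>Error plus regularisation: \<open>1 + p\<close> times the error cancels one factor of \<open>(p + 1)!\<close>.\<close>
      moreover have "(1 + real p) * (t / fact (Suc p)) = t / fact p" for t :: real
        by (simp add: divide_simps)
      from this[of "L $ i * (b * r) ^ Suc p"] have "e + p * e = L $ i / fact p * (b * r) ^ Suc p"
        by (simp add: e_def distrib_right add_divide_distrib del: fact_Suc power_Suc)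
      ultimately show ?thesis
        by linarith
    qed
    ultimately show ?thesis
      by linarith
  qed
  have "F ((1 - b) *\<^sub>R (x, f x) + b *\<^sub>R (z, f z)) \<le> ereal ((1 - b) * c + b * d)"
    using F vals b
    by (intro closed_convex_fun_le_convex_combination) (auto simp: composite_outer_def phi_def)
  moreover have "(1 - b) *\<^sub>R (x, f x) + b *\<^sub>R (z, f z) = (y, w)"
    by (simp add: y_def w_def algebra_simps)
  ultimately have Fw: "F (y, w) \<le> ereal ((1 - b) * c + b * d)"
    by simp
  then have Fw_fin: "F (y, w) < \<infinity>"
    by (auto intro: le_less_trans)
  have F\<Omega>: "F (y, \<Omega> y) \<le> F (y, w)"
    by (rule composite_outer_mono[OF F Fw_fin \<Omega>_le])
  \<comment> \<open>Only a feasible \<open>y\<close> may compete; feasibility refers to \<open>f y\<close>, not to the model.\<close>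
  have "F (y, f y) \<le> F (y, w)"
    by (rule composite_outer_mono[OF F Fw_fin]) (rule order_trans[OF f_le[OF yS] \<Omega>_le])
  then have "y \<in> dom_phi F S f"
    using yS Fw_fin by (auto simp: dom_phi_def eff_dom_def)
  then have "F (x', \<Omega> x') \<le> F (y, \<Omega> y)"
    using next_iterate by (force simp: is_arg_min_def model_def \<Omega>_def not_less)
  then have *: "F (x', \<Omega> x') \<le> ereal ((1 - b) * c + b * d)"
    using F\<Omega> Fw by order
  then have "F (x', \<Omega> x') < \<infinity>"
    by (auto intro: le_less_trans)
  then have "F (x', f x') \<le> F (x', \<Omega> x')"
    by (rule composite_outer_mono[OF F _ f_le[OF x'S]])
  then show ?thesis
    using * by (simp add: phi_def)
qed

theorem theorem3:
  fixes B :: "'a::euclidean_space \<Rightarrow> 'a \<Rightarrow>\<^sub>L real"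
    and F :: "'a \<times> (real^'m) \<Rightarrow> ereal"
    and dom_f :: "'a set"
    and f :: "'a \<Rightarrow> real^'m"
    and L \<sigma> :: "real^'m"
    and p :: nat
    and x :: "nat \<Rightarrow> 'a"
    and x_star :: 'a
  assumes p: "p \<ge> 1"
    and B: "pos_def_operator B"
    and F: "composite_outer F"
    and dom_f: "open dom_f" "convex dom_f"
    and f_closed_convex: "\<And>i. closed_convex_on dom_f (\<lambda>z. f z $ i)"
    and f_smooth: "\<And>i. C_times p (\<lambda>z. f z $ i) dom_f"
    and L_pos: "\<And>i. L $ i > 0"
    and f_lipschitz: "\<And>i. deriv_lipschitz_on B p (L $ i) (\<lambda>z. f z $ i) dom_f"
    and \<sigma>_pos: "\<And>i. \<sigma> $ i > 0"
    and f_uniformly_convex: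
      "\<And>i. uniformly_convex_on B (p + 1) (\<sigma> $ i) (\<lambda>z. f z $ i) dom_f"
    and minimizer: "x_star \<in> dom_phi F dom_f f" "phi F f x_star = phi_opt F dom_f f"
    and x_0: "x 0 \<in> dom_phi F dom_f f"
    and iterates: "full_step_method B p L F dom_f f x"
  shows "\<forall>k. phi F f (x k) - phi_opt F dom_f f
    \<le> ereal ((1 - beta_hat p L \<sigma>) ^ k) * (phi F f (x 0) - phi_opt F dom_f f)"
proof -
  define b where "b = beta_hat p L \<sigma>"
  have ratio_pos: "\<sigma> $ i / L $ i > 0" for i
    using L_pos \<sigma>_pos by simp
  have b_le_beta: "b \<le> beta p (\<sigma> $ i / L $ i) (real p)" for i
    unfolding b_def beta_hat_def by (intro Min_le) auto
  have "b \<in> range (\<lambda>i. beta p (\<sigma> $ i / L $ i) (real p))"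
    unfolding b_def beta_hat_def by (intro Min_in) auto
  then have b: "0 \<le> b" "b \<le> 1"
    using beta_bounds[OF ratio_pos, of "real p" p] by (auto simp: less_imp_le)
  have b_le: "(1 + real p) * b ^ p \<le> fact p * (\<sigma> $ i / L $ i) * (1 - b) ^ p" for i
    using le_beta_imp_power_le[OF p ratio_pos _ b(1) b_le_beta, of i] by simp
  have x_dom: "x k \<in> dom_phi F dom_f f" for k
    using iterates x_0 by (cases k) (auto simp: full_step_method_def is_arg_min_def)
  have finite_phi: "\<exists>c. phi F f y = ereal c" if "y \<in> dom_phi F dom_f f" for y
    using that F
    by (cases "F (y, f y)")
      (auto simp: dom_phi_def eff_dom_def phi_def composite_outer_def closed_convex_fun_def)
  obtain d where d: "phi F f x_star = ereal d"
    using finite_phi[OF minimizer(1)] by blast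
  obtain c where c: "\<And>k. phi F f (x k) = ereal (c k)"
    using finite_phi[OF x_dom] by metis
  have step: "c (Suc k) - d \<le> (1 - b) * (c k - d)" for k
  proof -
    have "phi F f (x (Suc k)) \<le> ereal ((1 - b) * c k + b * d)"
      using iterates
      by (intro full_step_decrease[OF p B F dom_f f_smooth L_pos f_lipschitz \<sigma>_pos
            f_uniformly_convex            b b_le x_dom minimizer(1) _ c d]) (simp add: full_step_method_def)
    then show ?thesis
      by (simp add: c algebra_simps)
  qed
  have "c k - d \<le> (1 - b) ^ k * (c 0 - d)" for k
  proof (induction k)
    case 0
    then show ?case
      by simp
  next
    case (Suc k)
    have "c (Suc k) - d \<le> (1 - b) * (c k - d)"
      by (rule step)
    also have "\<dots> \<le> (1 - b) * ((1 - b) ^ k * (c 0 - d))"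
      using Suc b by (intro mult_left_mono) auto
    finally show ?case
      by simp
  qed
  moreover have "phi_opt F dom_f f = ereal d"
    using minimizer(2) d by simp
  ultimately show ?thesis
    by (simp add: c b_def)
qed

end
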